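(* Let $g$ be either the function $g(x)=1-e^{-\lambda x}$ for some real number $\lambda\ge\ln 2$, or the function $g(x)=x^\alpha$, $x\geq 0$, for some real number $\alpha$ with $0<\alpha\le\frac12$. Then the quasi-complete graph $QK(n,m)$ uniquely minimizes $\Sigma_g$ over $\mathbb{G}(n,m)$ for any two integers $m$ and $n$ such that $n>0$ and $0\le m\le\binom n2$.
   Context: Graphs are finite and simple, with vertex set $\{1,\dots,n\}$; $\mathbb{G}(n,m)$ is the set of graphs with $n$ vertices and $m$ edges. For a graph with degree sequence $d=(d_1,\dots,d_n)$, $\Sigma_g(d)=\sum_{i=1}^n g(d_i)$. A graph $G\in\mathbb{G}(n,m)$ uniquely minimizes $\Sigma_g$ over $\mathbb{G}(n,m)$ if its degree sequence attains the minimum of $\Sigma_g$ among all degree sequences of graphs in $\mathbb{G}(n,m)$ and, up to isomorphism, $G$ is the only graph in $\mathbb{G}(n,m)$ whose degree sequence does so. $QK(n,m)$ is the graph on $\{1,\dots,n\}$ such that, with $q,r$ the unique integers satisfying $m=\binom q2+r$, $0\le r\le q-1$, the vertices $1,\dots,q$ induce a complete graph, vertex $q+1$ (if $q<n$) is adjacent exactly to $1,\dots,r$, and vertices $q+2,\dots,n$ are isolated. *)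

theory Defs
  imports Complex_Main "HOL-Library.Ramsey"
begin

text \<open>A graph on the vertex set \<open>{1..n}\<close> is represented by its set of edges, each edge being a
  two-element subset of \<open>{1..n}\<close>.\<close>

definition graphs :: "nat \<Rightarrow> nat \<Rightarrow> nat set set set" where
  "graphs n m = {E. E \<subseteq> nsets {1..n} 2 \<and> card E = m}"

definition degree :: "nat set set \<Rightarrow> nat \<Rightarrow> nat" where
  "degree E v = card {e \<in> E. v \<in> e}"

definition degree_sequence :: "nat \<Rightarrow> nat set set \<Rightarrow> nat list" where
  "degree_sequence n E = map (degree E) [1..<n + 1]"

definition Sigma_g :: "(real \<Rightarrow> real) \<Rightarrow> nat list \<Rightarrow> real" where
  "Sigma_g g d = (\<Sum>i<length d. g (real (d ! i)))"

definition isomorphic :: "nat \<Rightarrow> nat set set \<Rightarrow> nat set set \<Rightarrow> bool" where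
  "isomorphic n E F \<longleftrightarrow> (\<exists>f. bij_betw f {1..n} {1..n} \<and> F = (\<lambda>e. f ` e) ` E)"

definition minimizes :: "(real \<Rightarrow> real) \<Rightarrow> nat \<Rightarrow> nat \<Rightarrow> nat set set \<Rightarrow> bool" where
  "minimizes g n m G \<longleftrightarrow> G \<in> graphs n m \<and>
     (\<forall>d \<in> degree_sequence n ` graphs n m. Sigma_g g (degree_sequence n G) \<le> Sigma_g g d)"

definition uniquely_minimizes :: "(real \<Rightarrow> real) \<Rightarrow> nat \<Rightarrow> nat \<Rightarrow> nat set set \<Rightarrow> bool" where
  "uniquely_minimizes g n m G \<longleftrightarrow>
     minimizes g n m G \<and> (\<forall>H. minimizes g n m H \<longrightarrow> isomorphic n G H)"

text \<open>The condition \<open>0 \<le> r \<le> q - 1\<close> on integers is written \<open>r < q\<close>, because subtraction on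
  \<^typ>\<open>nat\<close> truncates. In particular \<open>q = 1\<close> and \<open>r = 0\<close> for \<open>m = 0\<close>.\<close>

definition QK_params :: "nat \<Rightarrow> nat \<times> nat" where
  "QK_params m = (THE (q, r). m = (q choose 2) + r \<and> r < q)"

lemma QK_params_unique: "\<exists>!(q, r). m = (q choose 2) + r \<and> r < (q :: nat)"
proof -
  have step: "(Suc q choose 2) = (q choose 2) + q" for q :: nat
    by (simp add: numeral_2_eq_2)
  have ex: "\<exists>q r. m = (q choose 2) + r \<and> r < (q :: nat)"
  proof (induction m)
    case 0
    have "0 = ((1 :: nat) choose 2) + 0 \<and> 0 < (1 :: nat)"
      by (simp add: binomial_eq_0)
    then show ?case by blast
  next
    case (Suc m)
    then obtain q r where qr: "m = (q choose 2) + r" "r < q" by blast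
    show ?case
    proof (cases "Suc r < q")
      case True
      with qr have "Suc m = (q choose 2) + Suc r \<and> Suc r < q" by simp
      then show ?thesis by blast
    next
      case False
      have "Suc r = q" using False qr(2) by simp
      then have "Suc m = (Suc q choose 2) + 0 \<and> 0 < Suc q"
        unfolding step qr(1) by simp
      then show ?thesis by blast
    qed
  qed
  have le: "q \<le> q'"
    if "(q choose 2) + r = (q' choose 2) + r'" "r < q" "r' < q'" for q q' r r' :: nat
  proof (rule ccontr)
    assume "\<not> q \<le> q'"
    then have "(Suc q' choose 2) \<le> (q choose 2)"
      by (intro binomial_right_mono) simp
    with step[of q'] that show False by linarith
  qed
  obtain q r where qr: "m = (q choose 2) + r" "r < q" using ex by blast
  show ?thesis
  proof (rule ex1I[of _ "(q, r)"])
    show "case (q, r) of (q, r) \<Rightarrow> m = (q choose 2) + r \<and> r < q"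
      unfolding prod.case using qr by (rule conjI)
  next
    fix p assume p: "case p of (q, r) \<Rightarrow> m = (q choose 2) + r \<and> r < q"
    obtain q' r' where [simp]: "p = (q', r')" by (rule prod.exhaust)
    have m: "m = (q' choose 2) + r'" and r': "r' < q'" using p by simp_all
    have eq: "(q choose 2) + r = (q' choose 2) + r'" using qr(1) m by (rule subst)
    have q: "q' = q"
      using le[OF eq[symmetric] r' qr(2)] le[OF eq qr(2) r'] by (rule order_antisym)
    have "r' = r" using eq unfolding q by (rule add_left_imp_eq[symmetric])
    with q show "p = (q, r)" by simp
  qed
qed

definition QK :: "nat \<Rightarrow> nat \<Rightarrow> nat set set" where
  "QK n m = (let (q, r) = QK_params m in
     nsets {1..q} 2 \<union> {{i, q + 1} | i. i \<in> {1..r} \<and> q < n})"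

end

theory Submission
  imports Defs
begin

text \<open>Only \<open>a k = g k\<close> for natural \<open>k\<close> matters. Both families satisfy \<open>a k \<ge> 2 k (a (k + 1) - a k)\<close>;
  this is where \<open>\<lambda> \<ge> ln 2\<close> and \<open>\<alpha> \<le> 1/2\<close> enter. In a minimizer with \<open>N\<close> non-isolated vertices, a vertex
  of minimum positive degree \<open>x\<close> could be deleted and replaced by \<open>x\<close> new edges among the other
  \<open>N - 1\<close> vertices at a profit (every
  increment occurs at a degree at least \<open>x\<close>), so these span fewer than \<open>x\<close> non-edges. Hence \<open>m\<close> exceeds the number of
  pairs of \<open>N - 1\<close> vertices, that is \<open>N \<le> q + 1\<close>, and the graph is complete on \<open>q + 1\<close> vertices minus
  a set \<open>C\<close> of \<open>c = q - r\<close> edges.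

  With \<open>\<psi> e = (a q - a (q - e)) / e\<close>, the weight lost by deleting \<open>C\<close> is the sum of
  \<open>\<psi> (deg u) + \<psi> (deg w)\<close> over the edges \<open>uw\<close> of \<open>C\<close>, degrees being taken in \<open>C\<close>. Since the increments of
  \<open>a\<close> are decreasing and strictly convex, \<open>\<psi>\<close> is increasing and strictly convex; as
  \<open>deg u + deg w \<le> c + 1\<close>, every edge contributes at most \<open>\<psi> 1 + \<psi> c\<close>, and equality forces \<open>C\<close> to be
  a star, whose deletion leaves the quasi-complete graph.\<close>

section \<open>Degrees\<close>

lemma Sigma_g_degree_sequence:
  "Sigma_g g (degree_sequence n E) = (\<Sum>v\<in>{1..n}. g (real (degree E v)))"
proof -
  have "Sigma_g g (degree_sequence n E) = (\<Sum>i<n. g (real (degree E (Suc i))))"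
    unfolding Sigma_g_def degree_sequence_def by (intro sum.cong) (auto simp del: upt_Suc)
  also have "\<dots> = (\<Sum>v\<in>{1..n}. g (real (degree E v)))"
    by (rule sum.reindex_bij_witness[of _ "\<lambda>v. v - 1" Suc]) auto
  finally show ?thesis .
qed

lemma inj_on_doubleton: "inj_on (\<lambda>i. {i, z}) A"
  by (auto simp: inj_on_def doubleton_eq_iff)

lemma degree_nsets:
  assumes "finite W" "w \<in> W"
  shows "degree (nsets W 2) w = card W - 1"
proof -
  have "{e \<in> nsets W 2. w \<in> e} = (\<lambda>i. {i, w}) ` (W - {w})"
    using assms by (auto simp: nsets_2_eq image_iff doubleton_eq_iff)
  then show ?thesis
    using assms by (simp add: degree_def card_image inj_on_doubleton)
qed

lemma degree_Un_disjoint: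
  assumes "finite A" "finite B" "A \<inter> B = {}"
  shows "degree (A \<union> B) v = degree A v + degree B v"
proof -
  have "{e \<in> A \<union> B. v \<in> e} = {e \<in> A. v \<in> e} \<union> {e \<in> B. v \<in> e}" by auto
  moreover have "{e \<in> A. v \<in> e} \<inter> {e \<in> B. v \<in> e} = {}" using assms(3) by blast
  ultimately show ?thesis
    using assms(1,2) by (simp add: degree_def card_Un_disjoint)
qed

lemma degree_outside:
  assumes "E \<subseteq> nsets W 2" "v \<notin> W"
  shows "degree E v = 0"
proof -
  have "{e \<in> E. v \<in> e} = {}"
    using assms by (auto simp: nsets_def)
  then show ?thesis unfolding degree_def by (simp only: card.empty)
qed

text \<open>Double counting of incident pairs of a vertex and an edge. A constant \<open>h\<close>
  gives the handshake identity; \<open>h v = \<psi> q (degree C v)\<close> turns losses at vertices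
  into charges on edges.\<close>

lemma sum_times_degree:
  fixes h :: "nat \<Rightarrow> real"
  assumes "finite W" "C \<subseteq> nsets W 2"
  shows "(\<Sum>v\<in>W. h v * real (degree C v)) = (\<Sum>e\<in>C. \<Sum>v\<in>e. h v)"
proof -
  have fin: "finite C"
    using assms finite_imp_finite_nsets finite_subset by blast
  have "(\<Sum>v\<in>W. h v * real (degree C v)) = (\<Sum>v\<in>W. \<Sum>e\<in>{e \<in> C. v \<in> e}. h v)"
    by (simp add: degree_def mult.commute)
  also have "\<dots> = (\<Sum>e\<in>C. \<Sum>v\<in>{v \<in> W. v \<in> e}. h v)"
    by (rule sum.swap_restrict[OF assms(1) fin])
  also have "\<dots> = (\<Sum>e\<in>C. \<Sum>v\<in>e. h v)"
  proof (rule sum.cong[OF refl])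
    fix e assume "e \<in> C"
    then have "{v \<in> W. v \<in> e} = e"
      using assms(2) by (auto simp: nsets_def)
    then show "(\<Sum>v\<in>{v \<in> W. v \<in> e}. h v) = (\<Sum>v\<in>e. h v)" by simp
  qed
  finally show ?thesis .
qed

lemma degree_pos_iff: "finite C \<Longrightarrow> 0 < degree C v \<longleftrightarrow> v \<in> \<Union>C"
  by (auto simp: degree_def card_gt_0_iff)

text \<open>Inclusion-exclusion: the only edge through both \<open>u\<close> and \<open>w\<close> is
  \<open>{u, w}\<close>, so the two sets of incident edges overlap in exactly one edge.\<close>

lemma degree_edge_le:
  assumes "finite C" "C \<subseteq> nsets W 2" "{u, w} \<in> C" "u \<noteq> w"
  shows "degree C u + degree C w \<le> card C + 1"
proof -
  let ?U = "{e \<in> C. u \<in> e}" and ?W = "{e \<in> C. w \<in> e}"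
  have "e = {u, w}" if "e \<in> C" "u \<in> e" "w \<in> e" for e
  proof -
    have "e \<in> nsets W 2" using assms(2) that(1) by blast
    then show ?thesis using that(2,3) assms(4) by (auto simp: nsets_2_eq)
  qed
  then have "?U \<inter> ?W = {{u, w}}"
    using assms(3) by blast
  moreover have "card ?U + card ?W = card (?U \<union> ?W) + card (?U \<inter> ?W)"
    using assms(1) by (intro card_Un_Int) auto
  moreover have "card (?U \<union> ?W) \<le> card C"
    using assms(1) by (intro card_mono) auto
  ultimately show ?thesis by (simp add: degree_def)
qed

text \<open>Counting forces every edge of \<open>C\<close> through \<open>z\<close>; this turns the
  equality case of the extremal bound into a star.\<close>

lemma star_of_degree_eq_card:
  assumes "finite C" "C \<subseteq> nsets W 2" "degree C z = card C"
  shows "C = (\<lambda>i. {i, z}) ` {i. {i, z} \<in> C}"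
proof -
  have "{e \<in> C. z \<in> e} = C"
    using assms(1,3) by (intro card_subset_eq) (auto simp: degree_def)
  then have z: "z \<in> e" if "e \<in> C" for e using that by auto
  show ?thesis
  proof (intro equalityI subsetI)
    fix e assume e: "e \<in> C"
    then have "e \<in> nsets W 2" using assms(2) by blast
    then obtain x y where "e = {x, y}" by (auto simp: nsets_2_eq)
    then obtain i where "e = {i, z}"
      using z[OF e] by (auto simp: doubleton_eq_iff)
    then show "e \<in> (\<lambda>i. {i, z}) ` {i. {i, z} \<in> C}" using e by auto
  qed auto
qed

section \<open>Convex sequences\<close>

text \<open>Moving the pair to \<open>x - 1\<close>, \<open>y + 1\<close> keeps the sum and, by
  convexity, raises the value; once the smaller argument is 1, monotonicity takes the larger one to
  \<open>c\<close>. Only the range from 1 to \<open>c\<close> is constrained, since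
  \<open>\<psi> q\<close> has a default value at 0 and loses its monotonicity beyond
  \<open>q\<close>.\<close>

lemma convex_seq_pair:
  fixes f :: "nat \<Rightarrow> real"
  assumes mono: "\<And>i. 1 \<le> i \<Longrightarrow> i < c \<Longrightarrow> f i < f (Suc i)"
    and conv: "\<And>i. 1 \<le> i \<Longrightarrow> Suc i < c \<Longrightarrow> f (Suc i) - f i < f (Suc (Suc i)) - f (Suc i)"
    and "1 \<le> x" "x \<le> y" "x + y \<le> c + 1" "\<not> (x = 1 \<and> y = c)"
  shows "f x + f y < f 1 + f c"
proof -
  have mono': "f i < f j" if "1 \<le> i" "i < j" "j \<le> c" for i j
    using that(2,1,3) by (induction rule: strict_inc_induct) (use mono in \<open>force+\<close>)
  have conv': "f (Suc i) - f i < f (Suc j) - f j" if "i < j" "1 \<le> i" "j < c" for i j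
    using that
  proof (induction j)
    case (Suc j)
    show ?case
    proof (cases "i = j")
      case True
      then show ?thesis using Suc conv by simp
    next
      case False
      then show ?thesis using Suc conv[of j] by simp
    qed
  qed simp
  show ?thesis using assms(3-6)
  proof (induction x arbitrary: y)
    case (Suc x)
    show ?case
    proof (cases "x = 0")
      case True
      then show ?thesis using Suc mono'[of y c] by simp
    next
      case False
      have "f (Suc x) + f y < f x + f (Suc y)"
        using conv'[of x y] False Suc.prems by simp
      \<comment> \<open>The new pair may already be the extreme one, where equality holds;
        strictness comes from the move just made.\<close>
      moreover have "f x + f (Suc y) \<le> f 1 + f c"
        using Suc.IH[of "Suc y"] False Suc.prems
        by (cases "x = 1 \<and> Suc y = c") (auto intro: less_imp_le)
      ultimately show ?thesis by simp
    qed
  qed simp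
qed

text \<open>\<open>dec\<close> and \<open>third\<close> make the increments strictly decreasing and
  strictly convex. \<open>half\<close> lets the weight of a vertex of degree \<open>k\<close> pay
  for \<open>k\<close> new edges, that is, for \<open>2 * k\<close> unit increases of degrees that
  are at least \<open>k\<close>.\<close>

locale edge_weight =
  fixes a :: "nat \<Rightarrow> real"
  assumes zero: "a 0 = 0"
    and inc: "a k < a (Suc k)"
    and dec: "a (Suc (Suc k)) - a (Suc k) < a (Suc k) - a k"
    and third: "0 < a (Suc (Suc (Suc k))) - 3 * a (Suc (Suc k)) + 3 * a (Suc k) - a k"
    and half: "2 * real k * (a (Suc k) - a k) \<le> a k"
begin

text \<open>For \<open>e\<close> from 1 to \<open>q\<close>, the mean of the \<open>e\<close>
  increments of \<open>a\<close> just below \<open>q\<close>: the loss per deleted edge at a vertex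
  whose degree drops from \<open>q\<close> to \<open>q - e\<close>. Division by zero gives
  \<open>\<psi> q 0 = 0\<close>.\<close>

definition \<psi> :: "nat \<Rightarrow> nat \<Rightarrow> real" where
  "\<psi> q e = (a q - a (q - e)) / real e"

section \<open>Increments of the weight and convexity of \<open>\<psi>\<close>\<close>

lemma mono_a: "i \<le> j \<Longrightarrow> a i \<le> a j"
  by (rule lift_Suc_mono_le[of a]) (use inc less_imp_le in auto)

lemma strict_mono_a: "i < j \<Longrightarrow> a i < a j"
  by (rule lift_Suc_mono_less[of a]) (use inc in auto)

lemma increment_antimono: "i \<le> j \<Longrightarrow> a (Suc j) - a j \<le> a (Suc i) - a i"
  by (rule lift_Suc_antimono_le[of "\<lambda>i. a (Suc i) - a i"]) (use dec less_imp_le in auto)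

lemma increment_bound: "x \<le> i \<Longrightarrow> a (i + d) - a i \<le> real d * (a (Suc x) - a x)"
proof (induction d)
  case (Suc d)
  then show ?case using increment_antimono[of x "i + d"] by (simp add: algebra_simps)
qed simp

text \<open>\<open>b e\<close> is the \<open>e\<close>-th increment of \<open>e \<mapsto> e \<psi> q e\<close>; \<open>U e\<close> is \<open>e (e + 1) (\<psi> q (e + 1) - \<psi> q e)\<close>.\<close>

lemma \<psi>_increments:
  assumes "1 \<le> e" "e < q"
  shows "\<psi> q e < \<psi> q (Suc e)"
    and "Suc e < q \<Longrightarrow> \<psi> q (Suc e) - \<psi> q e < \<psi> q (Suc (Suc e)) - \<psi> q (Suc e)"
proof -
  define b where "b e = a (q - e) - a (q - Suc e)" for e
  define U where "U e = real e * b e - (a q - a (q - e))" for e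
  have bmono: "b e < b (Suc e)" if "Suc e < q" for e
  proof -
    obtain k where "q = Suc (Suc e) + k" using le_Suc_ex[OF Suc_leI[OF \<open>Suc e < q\<close>]] by blast
    then show ?thesis using dec[of k] by (simp add: b_def)
  qed
  have wmono: "b (Suc e) - b e < b (Suc (Suc e)) - b (Suc e)" if "Suc (Suc e) < q" for e
  proof -
    obtain k where "q = Suc (Suc (Suc e)) + k"
      using le_Suc_ex[OF Suc_leI[OF \<open>Suc (Suc e) < q\<close>]] by blast
    then show ?thesis using third[of k] by (simp add: b_def numeral_3_eq_3)
  qed
  have U_Suc: "U (Suc e) = U e + (real e + 1) * (b (Suc e) - b e)" if "Suc e < q" for e
    using that by (simp add: U_def b_def algebra_simps)
  have U0: "U 0 = 0" by (simp add: U_def)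
  have U_pos: "1 \<le> e \<Longrightarrow> e < q \<Longrightarrow> 0 < U e" for e
  proof (induction e)
    case (Suc e)
    have "0 \<le> U e" using Suc U0 by (cases "e = 0") auto
    moreover have "0 < (real e + 1) * (b (Suc e) - b e)"
      using bmono[of e] Suc.prems by (intro mult_pos_pos) auto
    ultimately show ?case using U_Suc[of e] Suc.prems by simp
  qed simp
  \<comment> \<open>\<open>U e\<close> is the sum of \<open>(j + 1) * (b (j + 1) - b j)\<close> over
    \<open>j < e\<close>. The differences of \<open>b\<close> grow, so each is at most
    \<open>b (e + 1) - b e\<close>, and the factors \<open>j + 1\<close> add up to half of
    \<open>e * (e + 1)\<close>.\<close>
  have U_le: "Suc e < q \<Longrightarrow> 2 * U e \<le> real e * (real e + 1) * (b (Suc e) - b e)" for e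
  proof (induction e)
    case (Suc e)
    have "2 * U (Suc e) \<le> (real e + 1) * (real e + 2) * (b (Suc e) - b e)"
      using Suc U_Suc[of e] by (simp add: algebra_simps)
    also have "\<dots> \<le> (real e + 1) * (real e + 2) * (b (Suc (Suc e)) - b (Suc e))"
      using wmono[of e] Suc.prems by (intro mult_left_mono) auto
    finally show ?case by (simp add: algebra_simps)
  qed (simp add: U0)
  \<comment> \<open>The shift to \<open>Suc e\<close> makes strictness possible: both sides of
    \<open>U_le\<close> vanish at 0.\<close>
  have U_less: "2 * U (Suc e) < (real e + 1) * (real e + 2) * (b (Suc (Suc e)) - b (Suc e))"
    if "Suc (Suc e) < q" for e
  proof -
    have "2 * U (Suc e) \<le> (real e + 1) * (real e + 2) * (b (Suc e) - b e)"
      using U_le[of e] U_Suc[of e] that by (simp add: algebra_simps)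
    also have "\<dots> < (real e + 1) * (real e + 2) * (b (Suc (Suc e)) - b (Suc e))"
      using wmono[of e] that by (intro mult_strict_left_mono) auto
    finally show ?thesis .
  qed
  have \<psi>_diff: "\<psi> q (Suc e) - \<psi> q e = U e / (real e * (real e + 1))" if "1 \<le> e" for e
    using that by (simp add: \<psi>_def U_def b_def divide_simps) (simp add: algebra_simps)
  show "\<psi> q e < \<psi> q (Suc e)"
  proof -
    have "0 < U e / (real e * (real e + 1))"
      using U_pos[of e] assms by (intro divide_pos_pos mult_pos_pos) auto
    then show ?thesis using \<psi>_diff[of e] assms by simp
  qed
  show "\<psi> q (Suc e) - \<psi> q e < \<psi> q (Suc (Suc e)) - \<psi> q (Suc e)" if "Suc e < q"
  proof -
    \<comment> \<open>Cleared of denominators, the goal reads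
      \<open>(e + 2) * U e < e * U (e + 1)\<close>, which \<open>U_Suc\<close> reduces to this
      inequality.\<close>
    have "2 * U e < real e * (real e + 1) * (b (Suc e) - b e)"
      using U_less[of "e - 1"] assms that by (cases e) (auto simp: algebra_simps)
    moreover have "real e * U (Suc e) = real e * U e + real e * (real e + 1) * (b (Suc e) - b e)"
      unfolding U_Suc[OF that] by (simp add: algebra_simps)
    ultimately have "(real e + 2) * U e < real e * U (Suc e)"
      by (simp add: algebra_simps)
    then have "U e / (real e * (real e + 1)) < U (Suc e) / (real (Suc e) * (real (Suc e) + 1))"
    proof -
      have "U e / (real e * (real e + 1)) = (real e + 2) * U e / (real e * (real e + 1) * (real e + 2))"
        by (simp add: add_eq_0_iff)
      also have "\<dots> < real e * U (Suc e) / (real e * (real e + 1) * (real e + 2))"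
        using assms(1) \<open>(real e + 2) * U e < real e * U (Suc e)\<close>
        by (intro divide_strict_right_mono) auto
      also have "\<dots> = U (Suc e) / (real (Suc e) * (real (Suc e) + 1))"
        using assms(1) mult_divide_mult_cancel_left[of "real e" "U (Suc e)" "(real e + 1) * (real e + 2)"]
        by (simp add: mult.assoc add.commute)
      finally show ?thesis .
    qed
    then show ?thesis using \<psi>_diff[of e] \<psi>_diff[of "Suc e"] assms by simp
  qed
qed

section \<open>Graphs on \<open>q + 1\<close> vertices with few missing edges\<close>

lemma sum_weight_complement:
  assumes "finite W" "card W = Suc q" "E \<subseteq> nsets W 2" "C = nsets W 2 - E"
  shows "(\<Sum>v\<in>W. a (degree E v)) = real (Suc q) * a q - (\<Sum>e\<in>C. \<Sum>v\<in>e. \<psi> q (degree C v))"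
proof -
  have fin: "finite (nsets W 2)" using assms finite_imp_finite_nsets by blast
  have deg: "degree E v + degree C v = q" if "v \<in> W" for v
  proof -
    have "degree E v + degree C v = degree (E \<union> C) v"
      using fin assms(3,4) by (intro degree_Un_disjoint[symmetric]) (auto intro: finite_subset)
    also have "E \<union> C = nsets W 2" using assms by auto
    finally show ?thesis using degree_nsets[OF assms(1) that] assms(2) by simp
  qed
  have "a (degree E v) = a q - \<psi> q (degree C v) * real (degree C v)" if "v \<in> W" for v
  proof -
    have "degree E v = q - degree C v" using deg[OF that] by simp
    \<comment> \<open>If \<open>degree C v = 0\<close>, the product vanishes whatever the default
      value of \<open>\<psi> q 0\<close>, and nothing is lost at \<open>v\<close>.\<close>
    then show ?thesis by (simp add: \<psi>_def)
  qed
  then have "(\<Sum>v\<in>W. a (degree E v)) = (\<Sum>v\<in>W. a q - \<psi> q (degree C v) * real (degree C v))"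
    by simp
  also have "\<dots> = real (Suc q) * a q - (\<Sum>v\<in>W. \<psi> q (degree C v) * real (degree C v))"
    using assms(2) by (simp add: sum_subtractf)
  also have "(\<Sum>v\<in>W. \<psi> q (degree C v) * real (degree C v)) = (\<Sum>e\<in>C. \<Sum>v\<in>e. \<psi> q (degree C v))"
    using assms by (intro sum_times_degree) auto
  finally show ?thesis .
qed

text \<open>The endpoint degrees are positive with sum at most \<open>card C + 1\<close>, so
  \<open>convex_seq_pair\<close> applies; \<open>card C \<le> q\<close> keeps the arguments where
  \<open>\<psi> q\<close> is increasing and convex.\<close>

lemma edge_charge_le:
  assumes "finite C" "C \<subseteq> nsets W 2" "card C \<le> q" "e \<in> C"
  shows "(\<Sum>v\<in>e. \<psi> q (degree C v)) \<le> \<psi> q 1 + \<psi> q (card C)"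
    and "(\<Sum>v\<in>e. \<psi> q (degree C v)) = \<psi> q 1 + \<psi> q (card C) \<Longrightarrow> \<exists>z\<in>e. degree C z = card C"
proof -
  let ?c = "card C"
  have "e \<in> nsets W 2" using assms(2,4) by blast
  then obtain x0 y0 where xy0: "e = {x0, y0}" "x0 \<noteq> y0" by (auto simp: nsets_2_eq)
  obtain x y where xy: "e = {x, y}" "x \<noteq> y" "degree C x \<le> degree C y"
    using xy0 by (metis insert_commute nle_le)
  have sum: "(\<Sum>v\<in>e. \<psi> q (degree C v)) = \<psi> q (degree C x) + \<psi> q (degree C y)"
    using xy by simp
  have "1 \<le> degree C x" using assms(1,4) xy degree_pos_iff[of C x] by auto
  moreover have "degree C x + degree C y \<le> ?c + 1"
    using assms xy by (intro degree_edge_le) auto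
  ultimately have less: "\<psi> q (degree C x) + \<psi> q (degree C y) < \<psi> q 1 + \<psi> q ?c"
    if "\<not> (degree C x = 1 \<and> degree C y = ?c)"
    using assms(3) xy(3) that
    by (intro convex_seq_pair[of ?c "\<psi> q"] \<psi>_increments) auto
  show "(\<Sum>v\<in>e. \<psi> q (degree C v)) \<le> \<psi> q 1 + \<psi> q ?c"
    unfolding sum using less by (cases "degree C x = 1 \<and> degree C y = ?c") auto
  show "\<exists>z\<in>e. degree C z = ?c" if "(\<Sum>v\<in>e. \<psi> q (degree C v)) = \<psi> q 1 + \<psi> q ?c"
    using that less xy(1) unfolding sum by force
qed

text \<open>\<open>M\<close> is the weight left after deleting a star with \<open>card C\<close>
  edges. The charges are bounded edge by edge, so equality makes every edge of \<open>C\<close>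
  tight, and a single tight edge already exhibits the centre.\<close>

lemma near_complete_bound:
  assumes "finite W" "card W = Suc q" "E \<subseteq> nsets W 2" "C = nsets W 2 - E"
    "1 \<le> card C" "card C \<le> q"
  defines "M \<equiv> real (Suc q) * a q - real (card C) * (\<psi> q 1 + \<psi> q (card C))"
  shows "M \<le> (\<Sum>v\<in>W. a (degree E v))"
    and "(\<Sum>v\<in>W. a (degree E v)) = M \<Longrightarrow> \<exists>z\<in>W. degree C z = card C"
proof -
  let ?f = "\<lambda>e. \<Sum>v\<in>e. \<psi> q (degree C v)"
  have C: "finite C" "C \<subseteq> nsets W 2"
    using assms(1,4) finite_imp_finite_nsets by auto
  have eq: "(\<Sum>v\<in>W. a (degree E v)) = real (Suc q) * a q - sum ?f C"
    using assms by (intro sum_weight_complement) auto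
  have le: "?f e \<le> \<psi> q 1 + \<psi> q (card C)" if "e \<in> C" for e
    using edge_charge_le(1)[OF C assms(6) that] .
  have tot: "sum ?f C \<le> real (card C) * (\<psi> q 1 + \<psi> q (card C))"
    using sum_bounded_above[of C ?f "\<psi> q 1 + \<psi> q (card C)"] le by simp
  show "M \<le> (\<Sum>v\<in>W. a (degree E v))" using tot unfolding eq M_def by simp
  assume "(\<Sum>v\<in>W. a (degree E v)) = M"
  then have "sum ?f C = (\<Sum>e\<in>C. \<psi> q 1 + \<psi> q (card C))" unfolding eq M_def by simp
  moreover obtain e where e: "e \<in> C" using assms(5) by fastforce
  ultimately have "?f e = \<psi> q 1 + \<psi> q (card C)"
    using C(1) le sum_mono_inv[of ?f C "\<lambda>_. \<psi> q 1 + \<psi> q (card C)" e] by simp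
  then obtain z where "z \<in> e" "degree C z = card C"
    using edge_charge_le(2)[OF C assms(6) e] by blast
  then show "\<exists>z\<in>W. degree C z = card C"
    using e C(2) by (auto simp: nsets_def)
qed

text \<open>Every edge of the star joins \<open>z\<close> to a vertex of degree 1 in
  \<open>C\<close>, so every charge attains its bound.\<close>

lemma near_complete_star:
  assumes "finite W" "card W = Suc q" "E \<subseteq> nsets W 2" "C = nsets W 2 - E" "z \<in> W"
    "degree C z = card C"
  shows "(\<Sum>v\<in>W. a (degree E v)) = real (Suc q) * a q - real (card C) * (\<psi> q 1 + \<psi> q (card C))"
proof -
  have C: "finite C" "C \<subseteq> nsets W 2"
    using assms(1,4) finite_imp_finite_nsets by auto
  have star: "\<exists>i. e = {i, z}" if "e \<in> C" for e
    using star_of_degree_eq_card[OF C assms(6)] that by blast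
  have "(\<Sum>v\<in>e. \<psi> q (degree C v)) = \<psi> q 1 + \<psi> q (card C)" if "e \<in> C" for e
  proof -
    obtain i where i: "e = {i, z}" using star[OF \<open>e \<in> C\<close>] by blast
    have "{i, z} \<in> nsets W 2" using that i C(2) by blast
    then have ne: "i \<noteq> z" by (auto simp: nsets_2_eq doubleton_eq_iff)
    have "{e \<in> C. i \<in> e} = {{i, z}}"
    proof (intro equalityI subsetI)
      fix e' assume "e' \<in> {e \<in> C. i \<in> e}"
      then show "e' \<in> {{i, z}}" using star[of e'] ne by auto
    qed (use that i in auto)
    then have "degree C i = 1" by (simp add: degree_def)
    then show ?thesis using ne i assms(6) by simp
  qed
  then show ?thesis
    using sum_weight_complement[OF assms(1-4)] by simp
qed

section \<open>The number of non-isolated vertices of a minimizer\<close>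

lemma minimizer_support:
  assumes E: "E \<in> graphs n m" and "E \<noteq> {}"
    and min: "\<And>F. F \<in> graphs n m \<Longrightarrow>
      (\<Sum>v\<in>{1..n}. a (degree E v)) \<le> (\<Sum>v\<in>{1..n}. a (degree F v))"
  shows "(card (\<Union>E) - 1) choose 2 < m"
proof (rule ccontr)
  assume "\<not> ?thesis"
  then have m_le: "m \<le> (card (\<Union>E) - 1) choose 2" by simp
  define V where "V = \<Union>E"
  have E_sub: "E \<subseteq> nsets {1..n} 2" and card_E: "card E = m"
    using E by (auto simp: graphs_def)
  have fin_E: "finite E" using E_sub finite_imp_finite_nsets finite_subset by blast
  have V_sub: "V \<subseteq> {1..n}" using E_sub unfolding V_def nsets_def by blast
  have fin_V: "finite V" using V_sub finite_subset by blast
  have "V \<noteq> {}"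
  proof -
    obtain e where "e \<in> E" using \<open>E \<noteq> {}\<close> by blast
    moreover then have "e \<noteq> {}" using E_sub by (auto simp: nsets_def)
    ultimately show ?thesis unfolding V_def by blast
  qed
  then obtain v where v: "v \<in> V" "\<And>u. u \<in> V \<Longrightarrow> degree E v \<le> degree E u"
    using ex_is_arg_min_if_finite[OF fin_V, of "degree E"] unfolding is_arg_min_def
    by (metis not_le)
  define x where "x = degree E v"
  define U where "U = V - {v}"
  define E1 where "E1 = {e \<in> E. v \<in> e}"
  define E0 where "E0 = E - E1"
  have fin_U: "finite U" using fin_V by (simp add: U_def)
  have fin_E01: "finite E0" "finite E1" using fin_E by (auto simp: E0_def E1_def)
  have card_E1: "card E1 = x" by (simp add: E1_def x_def degree_def)
  have card_E0: "card E0 + x = m"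
  proof -
    have "E1 \<subseteq> E" by (auto simp: E1_def)
    then show ?thesis
      using card_E card_E1 fin_E card_mono[of E E1] by (simp add: E0_def card_Diff_subset fin_E01)
  qed
  have E0_sub: "E0 \<subseteq> nsets U 2"
    using E_sub unfolding E0_def E1_def U_def V_def nsets_def by blast
  have "card (nsets U 2) = (card V - 1) choose 2"
    using fin_V fin_U v(1) by (simp add: U_def)
  \<comment> \<open>By the negated claim \<open>U\<close> has at least
    \<open>m = card E0 + x\<close> pairs, so \<open>x\<close> of them are still free.\<close>
  then have "x \<le> card (nsets U 2 - E0)"
    using m_le card_E0 E0_sub fin_E01 by (simp add: card_Diff_subset V_def)
  then obtain A where A: "A \<subseteq> nsets U 2 - E0" "card A = x" "finite A"
    by (rule obtain_subset_with_card_n)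
  define F where "F = E0 \<union> A"
  have F_sub: "F \<subseteq> nsets U 2" using E0_sub A by (auto simp: F_def)
  have disj: "E0 \<inter> A = {}" using A by blast
  have "card F = m" using card_E0 A fin_E01 disj by (simp add: F_def card_Un_disjoint)
  moreover have "nsets U 2 \<subseteq> nsets {1..n} 2"
    using V_sub by (intro nsets_mono) (auto simp: U_def)
  ultimately have "F \<in> graphs n m" using F_sub by (auto simp: graphs_def)
  have deg_F: "degree F u = degree E0 u + degree A u" for u
    unfolding F_def using fin_E01(1) A(3) disj by (rule degree_Un_disjoint)
  have deg_E: "degree E u = degree E0 u + degree E1 u" for u
  proof -
    have "E = E0 \<union> E1" "E0 \<inter> E1 = {}" by (auto simp: E0_def E1_def)
    then show ?thesis using degree_Un_disjoint[OF fin_E01, of u] by simp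
  qed
  let ?D = "a (Suc x) - a x"
  have D_pos: "0 < ?D" using inc[of x] by simp
  \<comment> \<open>Increments are priced from \<open>degree E u\<close>, which is at least
    \<open>x\<close>; \<open>degree E0 u\<close> may be smaller. Putting the edges of
    \<open>E1\<close> back first only overestimates the weight, strictly so at neighbours of
    \<open>v\<close>.\<close>
  have le: "a (degree F u) \<le> a (degree E u) + real (degree A u) * ?D"
    and less: "0 < degree E1 u \<Longrightarrow> a (degree F u) < a (degree E u) + real (degree A u) * ?D"
    if "u \<in> U" for u
  proof -
    have x_le: "x \<le> degree E u" using v(2)[of u] that by (simp add: U_def x_def)
    show "a (degree F u) \<le> a (degree E u) + real (degree A u) * ?D"
    proof -
      have "a (degree F u) \<le> a (degree E u + degree A u)"
        using deg_F[of u] deg_E[of u] by (intro mono_a) simp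
      then show ?thesis using increment_bound[OF x_le, of "degree A u"] by simp
    qed
    show "a (degree F u) < a (degree E u) + real (degree A u) * ?D" if "0 < degree E1 u"
    proof -
      have "a (degree F u) < a (degree E u + degree A u)"
        using deg_F[of u] deg_E[of u] that by (intro strict_mono_a) simp
      then show ?thesis using increment_bound[OF x_le, of "degree A u"] by simp
    qed
  qed
  \<comment> \<open>A neighbour \<open>w\<close> of \<open>v\<close> supplies the one strict
    inequality in the sum.\<close>
  have "v \<in> \<Union>E" using v(1) by (simp add: V_def)
  then obtain e where e: "e \<in> E" "v \<in> e" by blast
  then have "e \<in> nsets {1..n} 2" using E_sub by blast
  then obtain w where w: "e = {v, w}" "w \<noteq> v" using e(2) by (auto elim!: nsets2_E)
  have w_U: "w \<in> U" using w e by (auto simp: U_def V_def)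
  have w_pos: "0 < degree E1 w" using w e fin_E01 by (auto simp: degree_pos_iff E1_def)
  have "(\<Sum>u\<in>{1..n}. a (degree F u)) = (\<Sum>u\<in>U. a (degree F u))"
  proof (rule sum.mono_neutral_right)
    show "\<forall>i\<in>{1..n} - U. a (degree F i) = 0"
      using degree_outside[OF F_sub] zero by simp
  qed (use V_sub in \<open>auto simp: U_def\<close>)
  also have "\<dots> < (\<Sum>u\<in>U. a (degree E u) + real (degree A u) * ?D)"
    using fin_U le less w_U w_pos by (intro sum_strict_mono_ex1) auto
  also have "\<dots> = (\<Sum>u\<in>U. a (degree E u)) + (\<Sum>u\<in>U. ?D * real (degree A u))"
    by (simp add: sum.distrib mult.commute)
  also have "(\<Sum>u\<in>U. ?D * real (degree A u)) = (\<Sum>e\<in>A. \<Sum>u\<in>e. ?D)"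
    using fin_U A by (intro sum_times_degree) auto
  also have "\<dots> = (\<Sum>e\<in>A. 2 * ?D)"
    using A(1) by (intro sum.cong) (auto simp: nsets_def)
  also have "\<dots> = 2 * real x * ?D" using A(2) by simp
  \<comment> \<open>The \<open>x\<close> new edges have \<open>2 * x\<close> ends; by
    \<open>half\<close> their cost is covered by the weight \<open>a x\<close> that \<open>v\<close>
    gives up.\<close>
  also have "(\<Sum>u\<in>U. a (degree E u)) + 2 * real x * ?D \<le> (\<Sum>u\<in>U. a (degree E u)) + a x"
    using half[of x] by simp
  also have "\<dots> = (\<Sum>u\<in>V. a (degree E u))"
    using fin_V v(1) by (simp add: U_def x_def sum.remove)
  also have "\<dots> = (\<Sum>u\<in>{1..n}. a (degree E u))"
  proof (rule sum.mono_neutral_left)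
    show "\<forall>i\<in>{1..n} - V. a (degree E i) = 0"
    proof
      fix i assume "i \<in> {1..n} - V"
      then have "degree E i = 0" using degree_pos_iff[OF fin_E, of i] by (simp add: V_def)
      then show "a (degree E i) = 0" using zero by simp
    qed
  qed (use V_sub in auto)
  finally show False using min[OF \<open>F \<in> graphs n m\<close>] by simp
qed

end

section \<open>Quasi-complete graphs\<close>

lemma bij_betw_extend:
  assumes "finite A" "finite B" "card A = card B" "bij_betw f A' B'" "A' \<subseteq> A" "B' \<subseteq> B"
  obtains g where "bij_betw g A B" "\<And>x. x \<in> A' \<Longrightarrow> g x = f x"
proof -
  have fin: "finite A'" "finite B'" using assms finite_subset by blast+
  have "card (A - A') = card (B - B')"
    using assms fin bij_betw_same_card[OF assms(4)] by (simp add: card_Diff_subset)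
  then obtain h where "bij_betw h (A - A') (B - B')"
    using assms(1,2) finite_same_card_bij[of "A - A'" "B - B'"] by auto
  then have "bij_betw (\<lambda>x. if x \<in> A' then f x else h x) (A' \<union> (A - A')) (B' \<union> (B - B'))"
    using assms(4) by (intro bij_betw_disjoint_Un) auto
  moreover have "A' \<union> (A - A') = A" "B' \<union> (B - B') = B" using assms(5,6) by auto
  ultimately show ?thesis using that[of "\<lambda>x. if x \<in> A' then f x else h x"] by simp
qed

text \<open>The relabelling is built in stages: \<open>{1..r}\<close> onto \<open>R\<close>,
  extended to \<open>{1..q}\<close> onto \<open>K\<close>, then \<open>q + 1\<close> to
  \<open>z\<close>, then arbitrarily on the isolated vertices.\<close>

lemma isomorphic_quasi_complete:
  assumes "q < n" "r \<le> q" "K \<subseteq> {1..n}" "card K = q" "R \<subseteq> K" "card R = r" "z \<in> {1..n} - K"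
  shows "isomorphic n (nsets {1..q} 2 \<union> (\<lambda>i. {i, q + 1}) ` {1..r}) (nsets K 2 \<union> (\<lambda>i. {i, z}) ` R)"
proof -
  have fin: "finite K" "finite R"
    using finite_subset[OF assms(3)] finite_subset[OF assms(5)] by auto
  obtain f1 where f1: "bij_betw f1 {1..r} R"
    using finite_same_card_bij[of "{1..r}" R] fin assms(6) by auto
  obtain f2 where f2: "bij_betw f2 {1..q} K" "\<And>x. x \<in> {1..r} \<Longrightarrow> f2 x = f1 x"
    using bij_betw_extend[of "{1..q}" K f1 "{1..r}" R] fin assms f1 by auto
  have "bij_betw (\<lambda>x. if x \<in> {1..q} then f2 x else z) ({1..q} \<union> {q + 1}) (K \<union> {z})"
    using f2(1) assms(7) by (intro bij_betw_disjoint_Un) auto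
  then obtain f where f: "bij_betw f {1..n} {1..n}"
    "\<And>x. x \<in> {1..q} \<union> {q + 1} \<Longrightarrow> f x = (if x \<in> {1..q} then f2 x else z)"
    using bij_betw_extend[of "{1..n}" "{1..n}" _ "{1..q} \<union> {q + 1}" "K \<union> {z}"] assms(1,3,7)
    by auto
  have "bij_betw f {1..q} K" using f2(1) f(2) bij_betw_cong[of "{1..q}" f f2 K] by simp
  then have "(`) f ` nsets {1..q} 2 = nsets K 2"
    using bij_betw_nsets[of f "{1..q}" K 2] by (simp add: bij_betw_def)
  moreover have "(`) f ` (\<lambda>i. {i, q + 1}) ` {1..r} = (\<lambda>i. {i, z}) ` R"
  proof -
    have "f i = f1 i" if "i \<in> {1..r}" for i using that f(2)[of i] f2(2)[of i] assms(2) by simp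
    then have "(`) f ` (\<lambda>i. {i, q + 1}) ` {1..r} = (\<lambda>i. {i, z}) ` f1 ` {1..r}"
      using f(2)[of "q + 1"] by (simp add: image_image)
    then show ?thesis using f1 by (simp add: bij_betw_def)
  qed
  ultimately have "nsets K 2 \<union> (\<lambda>i. {i, z}) ` R
      = (`) f ` (nsets {1..q} 2 \<union> (\<lambda>i. {i, q + 1}) ` {1..r})"
    by (simp add: image_Un)
  then show ?thesis using f(1) unfolding isomorphic_def by blast
qed

lemma QK_eq:
  obtains q r where "m = (q choose 2) + r" "r < q"
    "QK n m = nsets {1..q} 2 \<union> (if q < n then (\<lambda>i. {i, q + 1}) ` {1..r} else {})"
proof -
  obtain q r where qr: "QK_params m = (q, r)" by fastforce
  have "case QK_params m of (q, r) \<Rightarrow> m = (q choose 2) + r \<and> r < q"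
    unfolding QK_params_def by (rule theI') (rule QK_params_unique)
  then have "m = (q choose 2) + r" "r < q" using qr by auto
  moreover have "{{i, q + 1} | i. i \<in> {1..r} \<and> q < n}
      = (if q < n then (\<lambda>i. {i, q + 1}) ` {1..r} else {})"
    by auto
  then have "QK n m = nsets {1..q} 2 \<union> (if q < n then (\<lambda>i. {i, q + 1}) ` {1..r} else {})"
    by (simp only: QK_def qr Let_def prod.case)
  ultimately show ?thesis by (rule that)
qed

lemma QK_in_graphs:
  assumes "n > 0" "m \<le> n choose 2"
  shows "QK n m \<in> graphs n m"
proof -
  obtain q r where m: "m = (q choose 2) + r" and r: "r < q" and
    QK: "QK n m = nsets {1..q} 2 \<union> (if q < n then (\<lambda>i. {i, q + 1}) ` {1..r} else {})"
    by (rule QK_eq)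
  have Suc_choose: "Suc n choose 2 = (n choose 2) + n" by (simp add: numeral_2_eq_2)
  \<comment> \<open>Here \<open>n > 0\<close> enters: \<open>q > n\<close> would give
    \<open>m \<ge> (n choose 2) + n\<close>.\<close>
  have q: "q \<le> n"
  proof (rule ccontr)
    assume "\<not> q \<le> n"
    then have "Suc n choose 2 \<le> q choose 2" by (intro binomial_right_mono) simp
    then show False using m assms Suc_choose by simp
  qed
  have sub: "nsets {1..q} 2 \<subseteq> nsets {1..n} 2" using q by (intro nsets_mono) auto
  show ?thesis
  proof (cases "q < n")
    case True
    have "nsets {1..q} 2 \<inter> (\<lambda>i. {i, q + 1}) ` {1..r} = {}" by auto
    then have "card (nsets {1..q} 2 \<union> (\<lambda>i. {i, q + 1}) ` {1..r}) = m"
      by (simp add: m card_Un_disjoint finite_imp_finite_nsets card_image inj_on_doubleton)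
    then have "card (QK n m) = m" using True by (simp add: QK)
    moreover have "(\<lambda>i. {i, q + 1}) ` {1..r} \<subseteq> nsets {1..n} 2" using True r by auto
    ultimately show ?thesis using sub True by (simp add: graphs_def QK)
  next
    case False
    \<comment> \<open>The bound on \<open>m\<close> forces \<open>r = 0\<close>, so no edge is lost
      for want of a vertex \<open>q + 1\<close>.\<close>
    then have "q = n" "m = n choose 2" using q m assms(2) by auto
    moreover have "QK n m = nsets {1..q} 2" using False by (simp add: QK)
    ultimately show ?thesis by (simp add: graphs_def)
  qed
qed

text \<open>Stated for an arbitrary minimizer \<open>H\<close>, so that it yields both the
  minimality of \<open>QK n m\<close> and its uniqueness.\<close>

lemma (in edge_weight) QK_optimal:
  assumes n: "n > 0" and m_le: "m \<le> n choose 2" and H: "H \<in> graphs n m"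
    and min: "\<And>F. F \<in> graphs n m \<Longrightarrow>
      (\<Sum>v\<in>{1..n}. a (degree H v)) \<le> (\<Sum>v\<in>{1..n}. a (degree F v))"
  shows "(\<Sum>v\<in>{1..n}. a (degree (QK n m) v)) = (\<Sum>v\<in>{1..n}. a (degree H v)) \<and> isomorphic n (QK n m) H"
proof (cases "m = n choose 2")
  case True
  \<comment> \<open>The complete graph is treated apart because then \<open>q = n\<close> and there
    is no vertex \<open>q + 1\<close>.\<close>
  have "F = nsets {1..n} 2" if "F \<in> graphs n m" for F
    using that True by (intro card_subset_eq) (auto simp: graphs_def finite_imp_finite_nsets)
  then have "QK n m = H" using H QK_in_graphs[OF n m_le] by metis
  moreover have "isomorphic n H H" unfolding isomorphic_def by (intro exI[of _ id]) auto
  ultimately show ?thesis by simp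
next
  case False
  obtain q r where m: "m = (q choose 2) + r" and r: "r < q" and
    QK': "QK n m = nsets {1..q} 2 \<union> (if q < n then (\<lambda>i. {i, q + 1}) ` {1..r} else {})"
    by (rule QK_eq)
  have Suc_choose: "Suc q choose 2 = (q choose 2) + q" by (simp add: numeral_2_eq_2)
  have q: "q < n"
  proof (rule ccontr)
    assume "\<not> q < n"
    then have "n choose 2 \<le> q choose 2" by (intro binomial_right_mono) simp
    then show False using m m_le False by simp
  qed
  have QK: "QK n m = nsets {1..q} 2 \<union> (\<lambda>i. {i, q + 1}) ` {1..r}" using QK' q by simp
  have H_sub: "H \<subseteq> nsets {1..n} 2" and card_H: "card H = m" using H by (auto simp: graphs_def)
  have V_sub: "\<Union>H \<subseteq> {1..n}" using H_sub unfolding nsets_def by blast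
  have "card (\<Union>H) \<le> Suc q"
  proof (cases "H = {}")
    case False
    have "(card (\<Union>H) - 1) choose 2 < m" by (rule minimizer_support[OF H False min])
    then have "\<not> Suc q choose 2 \<le> (card (\<Union>H) - 1) choose 2" using m r Suc_choose by simp
    then have "\<not> Suc q \<le> card (\<Union>H) - 1" using binomial_right_mono by blast
    then show ?thesis by simp
  qed simp
  \<comment> \<open>The support is padded with isolated vertices to exactly \<open>q + 1\<close>; it
    can be smaller, for instance when \<open>r = 0\<close>.\<close>
  then obtain W where W: "\<Union>H \<subseteq> W" "W \<subseteq> {1..n}" "card W = Suc q"
    using exists_subset_between[of "\<Union>H" "Suc q" "{1..n}"] V_sub q by auto
  have fin_W: "finite W" using W(2) finite_subset by blast
  have restrict: "(\<Sum>v\<in>{1..n}. a (degree F v)) = (\<Sum>v\<in>X. a (degree F v))"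
    if "F \<subseteq> nsets X 2" "X \<subseteq> {1..n}" for F X
    using that degree_outside[OF that(1)] zero by (intro sum.mono_neutral_right) auto
  have H_W: "H \<subseteq> nsets W 2" using H_sub W(1) unfolding nsets_def by blast
  define C where "C = nsets W 2 - H"
  have fin_C: "finite C" "C \<subseteq> nsets W 2" using fin_W by (auto simp: C_def finite_imp_finite_nsets)
  have fin_H: "finite H" using H_W finite_subset[OF _ finite_imp_finite_nsets[OF fin_W]] by blast
  have card_C: "card C = q - r"
    using H_W fin_H card_H W(3) m by (simp add: C_def card_Diff_subset Suc_choose)
  let ?M = "real (Suc q) * a q - real (q - r) * (\<psi> q 1 + \<psi> q (q - r))"
  have H_ge: "?M \<le> (\<Sum>v\<in>W. a (degree H v))"
    using near_complete_bound(1)[OF fin_W W(3) H_W C_def] card_C r by simp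

  let ?W = "{1..q + 1}"
  define D where "D = nsets ?W 2 - QK n m"
  have QK_graph: "QK n m \<in> graphs n m" by (rule QK_in_graphs[OF n m_le])
  have QK_W: "QK n m \<subseteq> nsets ?W 2"
  proof -
    have "nsets {1..q} 2 \<subseteq> nsets ?W 2" by (intro nsets_mono) auto
    moreover have "(\<lambda>i. {i, q + 1}) ` {1..r} \<subseteq> nsets ?W 2" using r by auto
    ultimately show ?thesis by (simp add: QK)
  qed
  have fin_QK: "finite (QK n m)"
    using QK_W finite_subset[OF _ finite_imp_finite_nsets[of ?W 2]] by blast
  have card_D: "card D = q - r"
    using QK_W fin_QK QK_graph m by (simp add: D_def card_Diff_subset Suc_choose graphs_def)
  \<comment> \<open>The missing edges of the quasi-complete graph form a star at
    \<open>q + 1\<close>, since \<open>{1..q}\<close> is complete.\<close>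
  have "q + 1 \<in> e" if "e \<in> D" for e
  proof (rule ccontr)
    assume "q + 1 \<notin> e"
    moreover have "e \<in> nsets ?W 2" using that by (simp add: D_def)
    ultimately have "e \<in> nsets {1..q} 2"
      by (auto simp: nsets_def subset_iff le_Suc_eq)
    then show False using that by (simp add: D_def QK)
  qed
  then have "{e \<in> D. q + 1 \<in> e} = D" by blast
  then have "degree D (q + 1) = card D" by (simp add: degree_def)
  then have "(\<Sum>v\<in>?W. a (degree (QK n m) v)) = ?M"
    using near_complete_star[of ?W q "QK n m" D "q + 1"] QK_W D_def card_D by simp
  then have QK_sum: "(\<Sum>v\<in>{1..n}. a (degree (QK n m) v)) = ?M"
    using restrict[OF QK_W] q by simp
  \<comment> \<open>Minimality of \<open>H\<close> gives one inequality and \<open>H_ge\<close> the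
    other, so the equality case of the bound applies to \<open>H\<close>.\<close>
  then have H_eq: "(\<Sum>v\<in>W. a (degree H v)) = ?M"
    using H_ge min[OF QK_graph] restrict[OF H_W W(2)] by simp

  obtain z where z: "z \<in> W" "degree C z = card C"
    using near_complete_bound(2)[OF fin_W W(3) H_W C_def, unfolded card_C, OF _ _ H_eq] card_C r
    by (auto simp: Suc_le_eq)
  have C_z: "z \<in> e" if "e \<in> C" for e
    using star_of_degree_eq_card[OF fin_C z(2)] that by blast
  define K where "K = W - {z}"
  define R where "R = {i \<in> K. {i, z} \<in> H}"
  have fin_K: "finite K" "finite R" using fin_W by (auto simp: K_def R_def)
  have card_K: "card K = q" using z(1) W(3) fin_W by (simp add: K_def)
  have H_eq_QK: "H = nsets K 2 \<union> (\<lambda>i. {i, z}) ` R"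
  proof (intro equalityI subsetI)
    fix e assume e: "e \<in> H"
    then have "e \<in> nsets W 2" using H_W by blast
    then obtain x y where xy: "e = {x, y}" "x \<in> W" "y \<in> W" "x \<noteq> y" by (rule nsets2_E)
    consider "x = z" | "y = z" | "x \<noteq> z" "y \<noteq> z" by blast
    then show "e \<in> nsets K 2 \<union> (\<lambda>i. {i, z}) ` R"
    proof cases
      case 1
      then have "y \<in> R" "e = {y, z}" using xy e by (auto simp: R_def K_def insert_commute)
      then show ?thesis by blast
    next
      case 2
      then have "x \<in> R" "e = {x, z}" using xy e by (auto simp: R_def K_def)
      then show ?thesis by blast
    next
      case 3
      then show ?thesis using xy by (simp add: K_def)
    qed
  next
    fix e assume "e \<in> nsets K 2 \<union> (\<lambda>i. {i, z}) ` R"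
    then show "e \<in> H"
    proof
      assume "e \<in> nsets K 2"
      then have "e \<in> nsets W 2" "z \<notin> e" by (auto simp: K_def nsets_def)
      then show ?thesis using C_z[of e] by (auto simp: C_def)
    qed (auto simp: R_def)
  qed
  have "card R = r"
  proof -
    have "nsets K 2 \<inter> (\<lambda>i. {i, z}) ` R = {}" by (auto simp: K_def)
    then have "card H = (q choose 2) + card R"
      using fin_K card_K
      by (simp add: H_eq_QK card_Un_disjoint finite_imp_finite_nsets card_image inj_on_doubleton)
    then show ?thesis using card_H m by simp
  qed
  then have "isomorphic n (QK n m) H"
    unfolding QK using z(1) W(2) r q card_K
    by (subst H_eq_QK, intro isomorphic_quasi_complete) (auto simp: K_def R_def)
  then show ?thesis using QK_sum H_eq restrict[OF H_W W(2)] by simp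
qed

text \<open>There are finitely many graphs and at least one, so a minimizer exists;
  \<open>QK_optimal\<close> transfers its value to \<open>QK n m\<close>.\<close>

theorem (in edge_weight) QK_uniquely_minimizes:
  assumes "n > 0" "m \<le> n choose 2" "\<And>k. g (real k) = a k"
  shows "uniquely_minimizes g n m (QK n m)"
proof -
  let ?S = "\<lambda>E. \<Sum>v\<in>{1..n}. a (degree E v)"
  have S: "Sigma_g g (degree_sequence n E) = ?S E" for E
    by (simp only: Sigma_g_degree_sequence assms(3))
  have "graphs n m \<subseteq> Pow (nsets {1..n} 2)" by (auto simp: graphs_def)
  then have "finite (graphs n m)" by (rule finite_subset) (simp add: finite_imp_finite_nsets)
  moreover have QK: "QK n m \<in> graphs n m" by (rule QK_in_graphs[OF assms(1,2)])
  ultimately obtain H where H: "H \<in> graphs n m" "\<And>F. F \<in> graphs n m \<Longrightarrow> ?S H \<le> ?S F"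
    using ex_is_arg_min_if_finite[of "graphs n m" ?S] unfolding is_arg_min_def by (metis empty_iff not_le)
  have "?S (QK n m) = ?S H" using QK_optimal[OF assms(1,2) H] by blast
  then have "minimizes g n m (QK n m)" using QK H(2) by (simp add: minimizes_def S)
  moreover have "isomorphic n (QK n m) F" if "minimizes g n m F" for F
    using QK_optimal[OF assms(1,2), of F] that by (auto simp: minimizes_def S)
  ultimately show ?thesis by (simp add: uniquely_minimizes_def)
qed

section \<open>The two families of weights\<close>

text \<open>With \<open>t = exp (- l)\<close>, the differences of the weight are, up to sign,
  \<open>t ^ k\<close> times powers of \<open>1 - t\<close>.\<close>

lemma edge_weight_exp:
  assumes "l \<ge> ln 2"
  shows "edge_weight (\<lambda>k. 1 - exp (- l * real k))"
proof -
  define t where "t = exp (- l)"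
  have "t \<le> exp (- ln 2)" using assms by (simp add: t_def)
  also have "exp (- ln 2) = (1 / 2 :: real)" by (simp add: exp_minus)
  finally have t: "0 < t" "t \<le> 1 / 2" by (simp_all add: t_def)
  have exp_eq: "exp (- l * real k) = t ^ k" for k
    by (simp add: t_def exp_of_nat_mult[symmetric] mult.commute)
  have half: "2 * real k * (t ^ k * (1 - t)) + t ^ k \<le> 1" for k
  proof (induction k)
    case (Suc k)
    have "2 * real (Suc k) * (t ^ Suc k * (1 - t)) + t ^ Suc k
        = t * (2 * real k * (t ^ k * (1 - t)) + t ^ k) + 2 * t * (1 - t) * t ^ k"
      by (simp add: algebra_simps)
    \<comment> \<open>The hypothesis on \<open>l\<close> enters as
      \<open>2 * t \<le> 1\<close>.\<close>
    also have "\<dots> \<le> t * 1 + 1 * (1 - t) * 1"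
      using t Suc by (intro add_mono mult_mono mult_nonneg_nonneg power_le_one) auto
    finally show ?case by simp
  qed simp
  have "edge_weight (\<lambda>k. 1 - t ^ k)"
  proof
    fix k
    have pos: "0 < t ^ k" using t by simp
    show "1 - t ^ k < 1 - t ^ Suc k" using pos t by simp
    have "0 < t ^ k * (1 - t) ^ 2" using t by (intro mult_pos_pos) auto
    then show "1 - t ^ Suc (Suc k) - (1 - t ^ Suc k) < 1 - t ^ Suc k - (1 - t ^ k)"
      by (simp add: algebra_simps power2_eq_square)
    have "0 < t ^ k * (1 - t) ^ 3" using t by (intro mult_pos_pos) auto
    then show "0 < 1 - t ^ Suc (Suc (Suc k)) - 3 * (1 - t ^ Suc (Suc k)) + 3 * (1 - t ^ Suc k) - (1 - t ^ k)"
      by (simp add: algebra_simps power3_eq_cube)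
    show "2 * real k * (1 - t ^ Suc k - (1 - t ^ k)) \<le> 1 - t ^ k"
      using half[of k] by (simp add: algebra_simps)
  qed simp
  then show ?thesis by (simp only: exp_eq)
qed

text \<open>The increment \<open>d\<close> has derivative \<open>d'\<close>, which is negative and
  increasing; the mean value theorem carries both properties over to the second and third
  differences.\<close>

lemma edge_weight_powr:
  assumes "0 < \<alpha>" "\<alpha> \<le> 1 / 2"
  shows "edge_weight (\<lambda>k. real k powr \<alpha>)"
proof -
  define d where "d x = (x + 1) powr \<alpha> - x powr \<alpha>" for x :: real
  define d' where "d' x = \<alpha> * ((x + 1) powr (\<alpha> - 1) - x powr (\<alpha> - 1))" for x :: real
  have d'_neg: "d' x < 0" if "0 < x" for x
    using assms that by (simp add: d'_def mult_less_0_iff powr_less_mono2_neg)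
  have d'_mono: "d' x < d' y" if "0 < x" "x < y" for x y
  proof -
    define h where "h x = (x + 1) powr (\<alpha> - 1) - x powr (\<alpha> - 1)" for x :: real
    have "h x < h y"
    proof (rule DERIV_pos_imp_increasing[OF \<open>x < y\<close>])
      fix u assume "x \<le> u" "u \<le> y"
      then have u: "0 < u" using that by simp
      have "(h has_real_derivative (\<alpha> - 1) * (u + 1) powr (\<alpha> - 2) - (\<alpha> - 1) * u powr (\<alpha> - 2)) (at u)"
        unfolding h_def using u by (auto intro!: derivative_eq_intros)
      moreover have "(u + 1) powr (\<alpha> - 2) < u powr (\<alpha> - 2)"
        using assms u by (intro powr_less_mono2_neg) auto
      then have "0 < (1 - \<alpha>) * (u powr (\<alpha> - 2) - (u + 1) powr (\<alpha> - 2))"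
        using assms by (intro mult_pos_pos) auto
      then have "0 < (\<alpha> - 1) * (u + 1) powr (\<alpha> - 2) - (\<alpha> - 1) * u powr (\<alpha> - 2)"
        by (simp add: algebra_simps)
      ultimately show "\<exists>D. (h has_real_derivative D) (at u) \<and> 0 < D" by blast
    qed
    then show ?thesis using assms(1) by (simp add: d'_def h_def)
  qed
  \<comment> \<open>For \<open>k = 0\<close> the power is not differentiable at the left endpoint,
    where continuity suffices.\<close>
  have mvt_d: "\<exists>\<xi>. real k < \<xi> \<and> \<xi> < real k + 1 \<and> d (real k + 1) - d (real k) = d' \<xi>" for k
  proof -
    have "continuous_on {real k..real k + 1} d"
      unfolding d_def using assms(1) by (intro continuous_intros continuous_on_powr') auto
    moreover have "(d has_derivative (\<lambda>h. d' x * h)) (at x)" if "real k < x" for x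
    proof -
      have "(d has_real_derivative d' x) (at x)"
        unfolding d_def d'_def using that
        by (auto intro!: derivative_eq_intros simp: algebra_simps)
      then show ?thesis by (simp add: has_field_derivative_def)
    qed
    ultimately obtain \<xi> where "real k < \<xi>" "\<xi> < real k + 1"
      "d (real k + 1) - d (real k) = d' \<xi> * (real k + 1 - real k)"
      using mvt[of "real k" "real k + 1" d "\<lambda>x h. d' x * h"] by auto
    then show ?thesis by auto
  qed
  show ?thesis
  proof
    fix k
    obtain \<xi> where \<xi>: "real k < \<xi>" "\<xi> < real k + 1" "d (real k + 1) - d (real k) = d' \<xi>"
      using mvt_d by blast
    obtain \<eta> where \<eta>: "real (Suc k) < \<eta>" "d (real (Suc k) + 1) - d (real (Suc k)) = d' \<eta>"
      using mvt_d by blast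
    show "real k powr \<alpha> < real (Suc k) powr \<alpha>"
      using assms(1) by (intro powr_less_mono2) auto
    show "real (Suc (Suc k)) powr \<alpha> - real (Suc k) powr \<alpha> < real (Suc k) powr \<alpha> - real k powr \<alpha>"
      using \<xi> d'_neg[of \<xi>] by (simp add: d_def algebra_simps)
    \<comment> \<open>The mean value points lie in consecutive unit intervals, and the third
      difference is \<open>d' \<eta> - d' \<xi>\<close>.\<close>
    have "d' \<xi> < d' \<eta>" using \<xi> \<eta> by (intro d'_mono) auto
    then show "0 < real (Suc (Suc (Suc k))) powr \<alpha> - 3 * real (Suc (Suc k)) powr \<alpha>
        + 3 * real (Suc k) powr \<alpha> - real k powr \<alpha>"
      using \<xi>(3) \<eta>(2) by (simp add: d_def algebra_simps)
    show "2 * real k * (real (Suc k) powr \<alpha> - real k powr \<alpha>) \<le> real k powr \<alpha>"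
    proof (cases "k = 0")
      case False
      \<comment> \<open>Divided by \<open>k powr \<alpha>\<close>, the claim is
        \<open>2 * k * (s powr \<alpha> - 1) \<le> 1\<close> for the ratio \<open>s\<close> of
        \<open>k + 1\<close> to \<open>k\<close>; it follows from
        \<open>s powr \<alpha> \<le> sqrt s\<close> and the inequality of arithmetic and geometric
        means for \<open>s\<close> and 1.\<close>
      define s where "s = 1 + 1 / real k"
      have s: "1 \<le> s" "real (Suc k) = real k * s" using False by (auto simp: s_def field_simps)
      have "s powr \<alpha> \<le> s powr (1 / 2)" using s assms by (intro powr_mono) auto
      also have "\<dots> = sqrt s" using s by (simp add: powr_half_sqrt)
      also have "\<dots> \<le> (s + 1) / 2" using arith_geo_mean_sqrt[of s 1] s by simp
      finally have "2 * real k * (s powr \<alpha> - 1) \<le> 2 * real k * ((s + 1) / 2 - 1)"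
        by (intro mult_left_mono) auto
      also have "\<dots> = 1" using False by (simp add: s_def field_simps)
      finally have "real k powr \<alpha> * (2 * real k * (s powr \<alpha> - 1)) \<le> real k powr \<alpha> * 1"
        by (intro mult_left_mono) auto
      moreover have "real (Suc k) powr \<alpha> = real k powr \<alpha> * s powr \<alpha>"
        using s by (simp only: s(2)) (simp add: powr_mult)
      ultimately show ?thesis by (simp only:) (simp add: algebra_simps)
    qed simp
  qed simp
qed

theorem theorem11:
  fixes g :: "real \<Rightarrow> real" and n m :: nat
  assumes "(\<exists>l :: real. l \<ge> ln 2 \<and> g = (\<lambda>x. 1 - exp (- l * x))) \<or>
           (\<exists>\<alpha> :: real. 0 < \<alpha> \<and> \<alpha> \<le> 1 / 2 \<and> (\<forall>x\<ge>0. g x = x powr \<alpha>))"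
    and "n > 0" and "m \<le> n choose 2"
  shows "uniquely_minimizes g n m (QK n m)"
proof -
  obtain a where "edge_weight a" "\<And>k. g (real k) = a k"
    using assms(1)
  proof
    assume "\<exists>l\<ge>ln 2. g = (\<lambda>x. 1 - exp (- l * x))"
    then show ?thesis using edge_weight_exp that by metis
  next
    assume "\<exists>\<alpha>>0. \<alpha> \<le> 1 / 2 \<and> (\<forall>x\<ge>0. g x = x powr \<alpha>)"
    then show ?thesis using edge_weight_powr that of_nat_0_le_iff by metis
  qed
  then show ?thesis using edge_weight.QK_uniquely_minimizes assms(2,3) by blast
qed

end
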